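(* The set $\mathfrak X^*$ can be endowed with the structure of a disconnected 2-complex dimensional complex manifold. The respective complex analytic atlas $\mathcal A_I$ consists of the two non overlapping charts $(\mathfrak X^*_+,\mathcal M_+)$ and $(\mathfrak X^*_-,\mathcal M_-)$. In this manner, the complex structure in both $\mathfrak X^*_+$ and $\mathfrak X^*_-$ is that of $\mathcal P$ (inherited via $\mathcal M_\pm$).
   Context: The cross-ratio variety $\mathfrak X$ is the set of $(\mathbb X_1,\mathbb X_2,\mathbb X_3)\in\mathbb C^3$ with $|\mathbb X_3|^2=|\mathbb X_2|^2/|\mathbb X_1|^2$ and $2|\mathbb X_1|^2\Re(\mathbb X_3)=|\mathbb X_1|^2+|\mathbb X_2|^2-2\Re(\mathbb X_1)-2\Re(\mathbb X_2)+1$. Here $\mathfrak X^*=\{(\mathbb X_1,\mathbb X_2,\mathbb X_3)\in\mathfrak X:\Im(\mathbb X_3)\ne0\}$, $\mathfrak X^*_+=\{\Im(\mathbb X_3)>0\}\subset\mathfrak X^*$, $\mathfrak X^*_-=\{\Im(\mathbb X_3)<0\}\subset\mathfrak X^*$. The maps $\mathcal M_\pm$ are the restrictions to $\mathfrak X^*_\pm$ of the projection $\mathcal M:\mathfrak X\to\mathbb C^2$, $(\mathbb X_1,\mathbb X_2,\mathbb X_3)\mapsto(\mathbb X_1,\mathbb X_2)$; they take values in the open set $$\mathcal P=\{(\zeta_1,\zeta_2)\in\mathbb C^2:\ (|\zeta_1|-|\zeta_2|)^2<2\Re(\zeta_1)+2\Re(\zeta_2)-1\}.$$ *)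

theory Defs
  imports "HOL-Analysis.Analysis"
begin

section \<open>Complex manifolds given by an atlas\<close>

text \<open>Holomorphy in several variables, for open \<open>S\<close>: complex (Frechet) differentiability, i.e. the
  real derivative exists at every point of \<open>S\<close> and is complex linear.\<close>

definition holomorphic_map_on :: "(complex^'n::finite) set \<Rightarrow> (complex^'n \<Rightarrow> complex^'m) \<Rightarrow> bool" where
  "holomorphic_map_on S f \<longleftrightarrow>
     (\<forall>x\<in>S. \<exists>D. (f has_derivative D) (at x within S) \<and> Vector_Spaces.linear (*s) (*s) D)"

text \<open>A chart is a pair of its domain and a coordinate map whose values outside the
  domain are irrelevant. The complex dimension is the number of elements of the index type.\<close>

type_synonym ('a, 'n) chart = "'a set \<times> ('a \<Rightarrow> complex^'n)"

definition complex_chart :: "'a topology \<Rightarrow> ('a, 'n::finite) chart \<Rightarrow> bool" where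
  "complex_chart X c \<longleftrightarrow>
     (case c of (U, \<phi>) \<Rightarrow>
        openin X U \<and> open (\<phi> ` U) \<and>
        homeomorphic_map (subtopology X U) (top_of_set (\<phi> ` U)) \<phi>)"

definition complex_atlas :: "'a topology \<Rightarrow> ('a, 'n::finite) chart set \<Rightarrow> bool" where
  "complex_atlas X A \<longleftrightarrow>
     (\<forall>c\<in>A. complex_chart X c) \<and>
     (\<Union>(U, \<phi>)\<in>A. U) = topspace X \<and>
     (\<forall>(U, \<phi>)\<in>A. \<forall>(V, \<psi>)\<in>A. holomorphic_map_on (\<phi> ` (U \<inter> V)) (\<psi> \<circ> inv_into U \<phi>))"

definition complex_manifold :: "'a topology \<Rightarrow> ('a, 'n::finite) chart set \<Rightarrow> bool" where
  "complex_manifold X A \<longleftrightarrow> Hausdorff_space X \<and> second_countable X \<and> complex_atlas X A"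

definition holomorphic_between ::
  "'a topology \<Rightarrow> ('a, 'n::finite) chart set \<Rightarrow> 'b topology \<Rightarrow> ('b, 'm::finite) chart set \<Rightarrow> ('a \<Rightarrow> 'b) \<Rightarrow> bool" where
  "holomorphic_between X A Y B f \<longleftrightarrow>
     continuous_map X Y f \<and>
     (\<forall>(U, \<phi>)\<in>A. \<forall>(V, \<psi>)\<in>B.
        holomorphic_map_on (\<phi> ` (U \<inter> f -` V)) (\<psi> \<circ> f \<circ> inv_into U \<phi>))"

definition biholomorphic_map ::
  "'a topology \<Rightarrow> ('a, 'n::finite) chart set \<Rightarrow> 'b topology \<Rightarrow> ('b, 'm::finite) chart set \<Rightarrow> ('a \<Rightarrow> 'b) \<Rightarrow> bool" where
  "biholomorphic_map X A Y B f \<longleftrightarrow>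
     (\<exists>g. homeomorphic_maps X Y f g \<and>
          holomorphic_between X A Y B f \<and> holomorphic_between Y B X A g)"

definition restrict_atlas :: "('a, 'n::finite) chart set \<Rightarrow> 'a set \<Rightarrow> ('a, 'n::finite) chart set" where
  "restrict_atlas A W = (\<lambda>(U, \<phi>). (U \<inter> W, \<phi>)) ` A"

text \<open>The complex structure \<open>A\<close> of \<open>X\<close> is the one inherited from \<open>(Y, B)\<close> via \<open>f\<close>: the map \<open>f\<close> identifies
  \<open>(X, A)\<close> biholomorphically with an open submanifold of \<open>(Y, B)\<close>.\<close>

definition inherits_complex_structure_via ::
  "'a topology \<Rightarrow> ('a, 'n::finite) chart set \<Rightarrow> 'b topology \<Rightarrow> ('b, 'm::finite) chart set \<Rightarrow> ('a \<Rightarrow> 'b) \<Rightarrow> bool" where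
  "inherits_complex_structure_via X A Y B f \<longleftrightarrow>
     openin Y (f ` topspace X) \<and>
     biholomorphic_map X A
       (subtopology Y (f ` topspace X)) (restrict_atlas B (f ` topspace X)) f"


section \<open>The cross-ratio variety\<close>

text \<open>The quotient in the first equation presupposes \<open>X $ 1 \<noteq> 0\<close>; this has to be said
  explicitly because division is total here.\<close>

definition cross_ratio_variety :: "(complex^3) set" where
  "cross_ratio_variety =
     {X. X $ 1 \<noteq> 0 \<and>
         (cmod (X $ 3))\<^sup>2 = (cmod (X $ 2))\<^sup>2 / (cmod (X $ 1))\<^sup>2 \<and>
         2 * (cmod (X $ 1))\<^sup>2 * Re (X $ 3) =
           (cmod (X $ 1))\<^sup>2 + (cmod (X $ 2))\<^sup>2 - 2 * Re (X $ 1) - 2 * Re (X $ 2) + 1}"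

definition Xstar :: "(complex^3) set" where
  "Xstar = {X \<in> cross_ratio_variety. Im (X $ 3) \<noteq> 0}"

definition Xstar_plus :: "(complex^3) set" where
  "Xstar_plus = {X \<in> Xstar. Im (X $ 3) > 0}"

definition Xstar_minus :: "(complex^3) set" where
  "Xstar_minus = {X \<in> Xstar. Im (X $ 3) < 0}"

definition M_proj :: "complex^3 \<Rightarrow> complex^2" where
  "M_proj X = vector [X $ 1, X $ 2]"

definition M_plus :: "complex^3 \<Rightarrow> complex^2" where
  "M_plus = restrict M_proj Xstar_plus"

definition M_minus :: "complex^3 \<Rightarrow> complex^2" where
  "M_minus = restrict M_proj Xstar_minus"

definition P_domain :: "(complex^2) set" where
  "P_domain =
     {\<zeta>. (cmod (\<zeta> $ 1) - cmod (\<zeta> $ 2))\<^sup>2 < 2 * Re (\<zeta> $ 1) + 2 * Re (\<zeta> $ 2) - 1}"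

definition atlas_I :: "(complex^3, 2) chart set" where
  "atlas_I = {(Xstar_plus, M_plus), (Xstar_minus, M_minus)}"

definition atlas_P :: "(complex^2, 2) chart set" where
  "atlas_P = {(P_domain, id)}"

text \<open>Pitfall: neither \<open>M_plus\<close> nor \<open>M_minus\<close> is onto \<open>P_domain\<close>. At the points \<open>(t, 1 - t)\<close> of
  \<open>P_domain\<close> with \<open>0 < t < 1\<close> the defining equations force \<open>Im (X $ 3) = 0\<close>. Hence
  \<open>inherits_complex_structure_via\<close> asks for an open submanifold of the target and not for all of it.\<close>

lemma M_proj_Xstar_not_onto_P_domain:
  "(vector [1/2, 1/2] :: complex^2) \<in> P_domain - M_proj ` Xstar"
proof -
  have "(vector [1/2, 1/2] :: complex^2) \<notin> M_proj ` Xstar"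
  proof
    assume "(vector [1/2, 1/2] :: complex^2) \<in> M_proj ` Xstar"
    then obtain X where X: "X \<in> Xstar" and "(vector [1/2, 1/2] :: complex^2) = M_proj X" by blast
    then have e: "X $ 1 = 1/2" "X $ 2 = 1/2"
      unfolding M_proj_def by (metis vector_2(1), metis vector_2(2))
    have n: "(cmod (X $ 3))\<^sup>2 = 1" and r: "Re (X $ 3) = - 1"
      using X e by (auto simp: Xstar_def cross_ratio_variety_def norm_divide power_divide)
    have "Im (X $ 3) = 0"
      using n r by (simp add: cmod_power2)
    with X show False by (simp add: Xstar_def)
  qed
  then show ?thesis by (simp add: P_domain_def)
qed

end

theory Submission
  imports Defs
begin

text \<open>
  Write \<open>a = |\<zeta>\<^sub>1|\<close>, \<open>b = |\<zeta>\<^sub>2|\<close>, \<open>d = 2 Re \<zeta>\<^sub>1 + 2 Re \<zeta>\<^sub>2 - 1\<close>. For \<open>a \<noteq> 0\<close> the two equations of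
  the variety prescribe the modulus \<open>b / a\<close> and the real part \<open>r = (a\<^sup>2 + b\<^sup>2 - d) / (2 a\<^sup>2)\<close> of \<open>X\<^sub>3\<close>,
  so \<open>X\<^sub>3\<close> is one of the two conjugate numbers \<open>r \<plusminus> \<i> sqrt h\<close> with \<open>h = (b / a)\<^sup>2 - r\<^sup>2\<close>. Completing
  squares gives a Heron-type factorisation
    \<open>4 a\<^sup>4 h = (d - (a - b)\<^sup>2) ((a + b)\<^sup>2 - d)\<close>.
  The factors cannot both be negative because \<open>(a - b)\<^sup>2 \<le> (a + b)\<^sup>2\<close>; hence \<open>h > 0\<close> exactly on the
  open set \<open>(a - b)\<^sup>2 < d < (a + b)\<^sup>2\<close>, called \<open>projection_image\<close> below, which is contained in the
  domain \<open>(a - b)\<^sup>2 < d\<close>. The sign of \<open>Im X\<^sub>3\<close> selects the root, so the projection is a homeomorphism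
  from each of the two sheets onto this open set, with inverse \<open>section_of\<close>
  (lemma \<open>homeomorphic_maps_sheet\<close>).

  What remains is formal. The sheets are disjoint, open and nonempty, so the part of the variety with
  \<open>Im X\<^sub>3 \<noteq> 0\<close> is disconnected, and no two different charts overlap: the atlas is compatible because
  all transition maps are identities (\<open>complex_atlas_disjoint\<close>). In these charts the projection and its
  inverse are also identities, hence biholomorphic onto an open submanifold
  (\<open>inherits_complex_structure_single_chart\<close>).
\<close>

section \<open>Atlases with disjoint chart domains\<close>

text \<open>Transition maps, and the coordinate expressions of a chart and of its inverse, are the identity
  pointwise on their domain, but they are given as compositions with \<open>inv_into\<close>, whose values
  elsewhere are unspecified.\<close>

lemma holomorphic_map_on_identity:
  assumes "\<And>x. x \<in> S \<Longrightarrow> f x = x"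
  shows "holomorphic_map_on S f"
proof -
  have "(f has_derivative (\<lambda>h. h)) (at x within S)" if "x \<in> S" for x
    using has_derivative_ident that
    by (rule has_derivative_transform[rotated 2]) (use assms in auto)
  moreover have "Vector_Spaces.linear (*s) (*s) (\<lambda>h::complex^'n. h)"
    by (rule vec.linear_id[unfolded id_def])
  ultimately show ?thesis
    unfolding holomorphic_map_on_def by blast
qed

lemma complex_atlas_disjoint:
  assumes charts: "\<And>c. c \<in> A \<Longrightarrow> complex_chart X c"
    and cover: "(\<Union>(U, \<phi>)\<in>A. U) = topspace X"
    and disjoint: "\<And>U \<phi> V \<psi>. (U, \<phi>) \<in> A \<Longrightarrow> (V, \<psi>) \<in> A \<Longrightarrow> (U, \<phi>) \<noteq> (V, \<psi>) \<Longrightarrow> U \<inter> V = {}"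
  shows "complex_atlas X A"
proof -
  have "holomorphic_map_on (\<phi> ` (U \<inter> V)) (\<psi> \<circ> inv_into U \<phi>)"
    if "(U, \<phi>) \<in> A" "(V, \<psi>) \<in> A" for U \<phi> V \<psi>
  proof (rule holomorphic_map_on_identity)
    fix x assume x: "x \<in> \<phi> ` (U \<inter> V)"
    with disjoint[OF that] have "\<psi> = \<phi>" by auto
    with x show "(\<psi> \<circ> inv_into U \<phi>) x = x"
      by (auto intro: f_inv_into_f)
  qed
  with charts cover show ?thesis
    unfolding complex_atlas_def by blast
qed

lemma complex_manifold_top_of_set:
  fixes S :: "'a::{t2_space, second_countable_topology} set"
  assumes "complex_atlas (top_of_set S) A"
  shows "complex_manifold (top_of_set S) A"
proof -
  obtain B :: "'a set set" where "countable B" "\<And>U. U \<in> B \<Longrightarrow> open U"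
    and "\<And>S. open S \<Longrightarrow> \<exists>C. C \<subseteq> B \<and> S = \<Union>C"
    using univ_second_countable by metis
  then have "second_countable (euclidean :: 'a topology)"
    unfolding second_countable_def by (metis Union_iff open_openin subset_eq Union_upper)
  moreover have "Hausdorff_space (euclidean :: 'a topology)"
    using hausdorff by (auto simp: Hausdorff_space_def disjnt_def)
  ultimately show ?thesis
    using assms unfolding complex_manifold_def
    by (simp add: second_countable_subtopology Hausdorff_space_subtopology)
qed

text \<open>The chart with empty domain is what remains of the other sheet's
  chart after an atlas has been restricted to one sheet.\<close>

lemma inherits_complex_structure_single_chart:
  assumes hom: "homeomorphic_maps (top_of_set U) (top_of_set Q) \<phi> g"
    and Q: "open Q" "Q \<subseteq> P"
  shows "inherits_complex_structure_via (top_of_set U) {(U, \<phi>), ({}, \<psi>)} (top_of_set P) {(P, id)} \<phi>"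
proof -
  have cont: "continuous_map (top_of_set U) (top_of_set Q) \<phi>"
      "continuous_map (top_of_set Q) (top_of_set U) g"
    and g\<phi>: "\<And>x. x \<in> U \<Longrightarrow> g (\<phi> x) = x" and \<phi>g: "\<And>y. y \<in> Q \<Longrightarrow> \<phi> (g y) = y"
    using hom by (auto simp: homeomorphic_maps_def)
  have \<phi>U: "\<phi> ` U \<subseteq> Q" and gQ: "g ` Q \<subseteq> U"
    using cont by (auto dest!: continuous_map_image_subset_topspace)
  have im: "\<phi> ` U = Q"
    using \<phi>U gQ \<phi>g by force
  have target: "subtopology (top_of_set P) Q = top_of_set Q" "restrict_atlas {(P, id)} Q = {(Q, id)}"
    using Q by (auto simp: subtopology_subtopology restrict_atlas_def Int_absorb1)
  have "holomorphic_between (top_of_set U) {(U, \<phi>), ({}, \<psi>)} (top_of_set Q) {(Q, id)} \<phi>"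
    unfolding holomorphic_between_def using cont
    by (auto intro!: holomorphic_map_on_identity simp: f_inv_into_f)
  moreover have "holomorphic_between (top_of_set Q) {(Q, id)} (top_of_set U) {(U, \<phi>), ({}, \<psi>)} g"
    unfolding holomorphic_between_def using cont \<phi>g
    by (auto intro!: holomorphic_map_on_identity simp: inv_into_f_f[OF inj_on_id, unfolded id_def] id_def)
  ultimately have "biholomorphic_map (top_of_set U) {(U, \<phi>), ({}, \<psi>)} (top_of_set Q) {(Q, id)} \<phi>"
    unfolding biholomorphic_map_def using hom by blast
  moreover have "openin (top_of_set P) Q"
    using Q by (simp add: open_subset)
  ultimately show ?thesis
    unfolding inherits_complex_structure_via_def by (simp add: im target)
qed

section \<open>Solving the defining equations for the third coordinate\<close>

definition re_X3 :: "complex^2 \<Rightarrow> real" where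
  "re_X3 \<zeta> = ((cmod (\<zeta> $ 1))\<^sup>2 + (cmod (\<zeta> $ 2))\<^sup>2 - (2 * Re (\<zeta> $ 1) + 2 * Re (\<zeta> $ 2) - 1))
             / (2 * (cmod (\<zeta> $ 1))\<^sup>2)"

definition im_X3_sq :: "complex^2 \<Rightarrow> real" where
  "im_X3_sq \<zeta> = (cmod (\<zeta> $ 2))\<^sup>2 / (cmod (\<zeta> $ 1))\<^sup>2 - (re_X3 \<zeta>)\<^sup>2"

text \<open>The common image of both sheets, encoded by strict inequalities between continuous functions
  so that its openness is immediate. They say that \<open>|\<zeta>\<^sub>1|\<close>, \<open>|\<zeta>\<^sub>2|\<close> and
  \<open>sqrt (2 Re \<zeta>\<^sub>1 + 2 Re \<zeta>\<^sub>2 - 1)\<close> are the sides of a nondegenerate triangle.\<close>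

definition projection_image :: "(complex^2) set" where
  "projection_image = {\<zeta> \<in> P_domain. 2 * Re (\<zeta> $ 1) + 2 * Re (\<zeta> $ 2) - 1 < (cmod (\<zeta> $ 1) + cmod (\<zeta> $ 2))\<^sup>2}"

text \<open>The sign \<open>s\<close> is \<open>1\<close> or \<open>-1\<close>; it treats both sheets at once.\<close>

definition sheet :: "real \<Rightarrow> (complex^3) set" where
  "sheet s = {X \<in> Xstar. 0 < s * Im (X $ 3)}"

definition section_of :: "real \<Rightarrow> complex^2 \<Rightarrow> complex^3" where
  "section_of s \<zeta> = vector [\<zeta> $ 1, \<zeta> $ 2, Complex (re_X3 \<zeta>) (s * sqrt (im_X3_sq \<zeta>))]"

text \<open>The difference on the left is \<open>(d - (a - b)\<^sup>2) ((a + b)\<^sup>2 - d) / (4 a\<^sup>4)\<close>, and at least one of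
  the two factors is nonnegative.\<close>

lemma heron_factorisation_pos_iff:
  fixes a b d :: real
  assumes "0 < a" "0 \<le> b"
  shows "0 < b\<^sup>2 / a\<^sup>2 - ((a\<^sup>2 + b\<^sup>2 - d) / (2 * a\<^sup>2))\<^sup>2 \<longleftrightarrow> (a - b)\<^sup>2 < d \<and> d < (a + b)\<^sup>2"
proof -
  have "b\<^sup>2 / a\<^sup>2 - ((a\<^sup>2 + b\<^sup>2 - d) / (2 * a\<^sup>2))\<^sup>2 = (d - (a - b)\<^sup>2) * ((a + b)\<^sup>2 - d) / (4 * a ^ 4)"
    using assms by (simp add: field_simps power2_eq_square power4_eq_xxxx)
  moreover have "(a - b)\<^sup>2 \<le> (a + b)\<^sup>2"
    using assms by (simp add: power2_eq_square algebra_simps)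
  ultimately show ?thesis
    using assms by (auto simp: zero_less_divide_iff zero_less_mult_iff)
qed

text \<open>If \<open>\<zeta>\<^sub>1 = 0\<close>, the two inequalities would squeeze \<open>d\<close> strictly between \<open>b\<^sup>2\<close> and itself.\<close>

lemma projection_image_nonzero:
  assumes "\<zeta> \<in> projection_image"
  shows "\<zeta> $ 1 \<noteq> 0"
  using assms by (auto simp: projection_image_def P_domain_def)

lemma projection_image_iff:
  assumes "\<zeta> $ 1 \<noteq> 0"
  shows "\<zeta> \<in> projection_image \<longleftrightarrow> 0 < im_X3_sq \<zeta>"
  using heron_factorisation_pos_iff[of "cmod (\<zeta> $ 1)" "cmod (\<zeta> $ 2)"] assms
  by (simp add: projection_image_def P_domain_def im_X3_sq_def re_X3_def)

lemma cross_ratio_variety_iff: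
  "X \<in> cross_ratio_variety \<longleftrightarrow>
     X $ 1 \<noteq> 0 \<and> Re (X $ 3) = re_X3 (M_proj X) \<and> (Im (X $ 3))\<^sup>2 = im_X3_sq (M_proj X)"
proof (cases "X $ 1 = 0")
  case False
  then have "2 * (cmod (X $ 1))\<^sup>2 * Re (X $ 3) =
        (cmod (X $ 1))\<^sup>2 + (cmod (X $ 2))\<^sup>2 - 2 * Re (X $ 1) - 2 * Re (X $ 2) + 1
      \<longleftrightarrow> Re (X $ 3) = re_X3 (M_proj X)"
    by (auto simp: re_X3_def M_proj_def field_simps)
  moreover have "(cmod (X $ 3))\<^sup>2 = (cmod (X $ 2))\<^sup>2 / (cmod (X $ 1))\<^sup>2
      \<longleftrightarrow> (Im (X $ 3))\<^sup>2 = im_X3_sq (M_proj X)" if "Re (X $ 3) = re_X3 (M_proj X)"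
    using that by (auto simp: im_X3_sq_def cmod_power2[of "X $ 3"] M_proj_def)
  ultimately show ?thesis
    using False by (auto simp: cross_ratio_variety_def)
qed (simp add: cross_ratio_variety_def)

lemma M_proj_sheet:
  assumes "X \<in> sheet s"
  shows "M_proj X \<in> projection_image"
proof -
  have "Im (X $ 3) \<noteq> 0" "M_proj X $ 1 \<noteq> 0" "(Im (X $ 3))\<^sup>2 = im_X3_sq (M_proj X)"
    using assms by (auto simp: sheet_def Xstar_def cross_ratio_variety_iff M_proj_def)
  then show ?thesis
    by (metis projection_image_iff zero_less_power2)
qed

lemma M_proj_section_of: "M_proj (section_of s \<zeta>) = \<zeta>"
  by (simp add: M_proj_def section_of_def vec_eq_iff forall_2)

lemma section_of_in_sheet:
  assumes "\<zeta> \<in> projection_image" and "\<bar>s\<bar> = 1"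
  shows "section_of s \<zeta> \<in> sheet s"
proof -
  have z: "\<zeta> $ 1 \<noteq> 0" and pos: "0 < im_X3_sq \<zeta>"
    using assms projection_image_nonzero projection_image_iff by auto
  have s: "s * s = 1" "s\<^sup>2 = 1"
    using assms(2) by (auto simp: abs_if power2_eq_square split: if_splits)
  have coords: "section_of s \<zeta> $ 1 = \<zeta> $ 1" "Re (section_of s \<zeta> $ 3) = re_X3 \<zeta>"
      "Im (section_of s \<zeta> $ 3) = s * sqrt (im_X3_sq \<zeta>)"
    by (simp_all add: section_of_def)
  have "section_of s \<zeta> \<in> cross_ratio_variety"
    using z pos s by (simp add: cross_ratio_variety_iff coords M_proj_section_of power_mult_distrib)
  moreover have "0 < s * Im (section_of s \<zeta> $ 3)"
    using pos s by (simp add: coords flip: mult.assoc)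
  ultimately show ?thesis
    by (auto simp: sheet_def Xstar_def)
qed

lemma section_of_M_proj:
  assumes "X \<in> sheet s" and "\<bar>s\<bar> = 1"
  shows "section_of s (M_proj X) = X"
proof -
  have X: "Re (X $ 3) = re_X3 (M_proj X)" "im_X3_sq (M_proj X) = (Im (X $ 3))\<^sup>2" "0 < s * Im (X $ 3)"
    using assms by (auto simp: sheet_def Xstar_def cross_ratio_variety_iff)
  have "s * \<bar>Im (X $ 3)\<bar> = Im (X $ 3)"
    using assms(2) X(3) by (auto simp: abs_if split: if_splits)
  then show ?thesis
    using X by (simp add: section_of_def vec_eq_iff forall_3 complex_eq_iff) (simp add: M_proj_def)
qed

section \<open>The projection as a chart on each sheet\<close>

lemma open_projection_image: "open projection_image"
  unfolding projection_image_def P_domain_def Collect_conj_eq mem_Collect_eq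
  by (intro open_Int open_Collect_less continuous_intros)

lemma open_P_domain: "open P_domain"
  unfolding P_domain_def by (intro open_Collect_less continuous_intros)

lemma continuous_on_componentwise_vec:
  fixes f :: "'a::topological_space \<Rightarrow> 'b::topological_space^'n"
  assumes "\<And>i. continuous_on S (\<lambda>x. f x $ i)"
  shows "continuous_on S f"
  using continuous_on_vec_lambda[of S "\<lambda>i x. f x $ i"] assms by simp

lemma continuous_on_M_proj: "continuous_on S M_proj"
proof (rule continuous_on_componentwise_vec)
  fix i :: 2
  consider "i = 1" | "i = 2" using exhaust_2 by blast
  then show "continuous_on S (\<lambda>X. M_proj X $ i)"
    by cases (simp_all add: M_proj_def continuous_intros)
qed

lemma continuous_on_section_of: "continuous_on projection_image (section_of s)"
proof (rule continuous_on_componentwise_vec)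
  have re: "continuous_on projection_image re_X3"
    unfolding re_X3_def
    by (intro continuous_intros) (auto dest: projection_image_nonzero)
  have im: "continuous_on projection_image im_X3_sq"
    unfolding im_X3_sq_def
    by (intro continuous_intros re) (auto dest: projection_image_nonzero)
  fix i :: 3
  consider "i = 1" | "i = 2" | "i = 3" using exhaust_3 by blast
  then show "continuous_on projection_image (\<lambda>\<zeta>. section_of s \<zeta> $ i)"
    by cases (simp_all add: section_of_def Complex_eq re im continuous_intros)
qed

lemma homeomorphic_maps_sheet:
  assumes "\<bar>s\<bar> = 1"
  shows "homeomorphic_maps (top_of_set (sheet s)) (top_of_set projection_image) M_proj (section_of s)"
  unfolding homeomorphic_maps_def
  using assms continuous_on_M_proj continuous_on_section_of
  by (auto simp: M_proj_sheet section_of_in_sheet section_of_M_proj M_proj_section_of)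

lemma sheet_eq: "Xstar_plus = sheet 1" "Xstar_minus = sheet (-1)"
  by (auto simp: Xstar_plus_def Xstar_minus_def sheet_def)

lemma homeomorphic_maps_M_plus:
  "homeomorphic_maps (top_of_set Xstar_plus) (top_of_set projection_image) M_plus (section_of 1)"
  by (rule homeomorphic_maps_eq[OF homeomorphic_maps_sheet[of 1, folded sheet_eq]])
     (auto simp: M_plus_def)

lemma homeomorphic_maps_M_minus:
  "homeomorphic_maps (top_of_set Xstar_minus) (top_of_set projection_image) M_minus (section_of (-1))"
  by (rule homeomorphic_maps_eq[OF homeomorphic_maps_sheet[of "-1", folded sheet_eq]])
     (auto simp: M_minus_def)

lemma openin_sheet: "openin (top_of_set Xstar) (sheet s)"
proof -
  have "open {X :: complex^3. 0 < s * Im (X $ 3)}"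
    by (intro open_Collect_less continuous_intros)
  then show ?thesis
    by (auto simp: openin_open sheet_def)
qed

lemma complex_chart_sheet:
  assumes hom: "homeomorphic_maps (top_of_set (sheet s)) (top_of_set projection_image) \<phi> g"
  shows "complex_chart (top_of_set Xstar) (sheet s, \<phi>)"
proof -
  have map: "homeomorphic_map (top_of_set (sheet s)) (top_of_set projection_image) \<phi>"
    using hom by (auto simp: homeomorphic_map_maps)
  then have "\<phi> ` sheet s = projection_image"
    using homeomorphic_imp_surjective_map by fastforce
  moreover have "sheet s \<subseteq> Xstar"
    by (auto simp: sheet_def)
  ultimately show ?thesis
    using map openin_sheet open_projection_image
    by (simp add: complex_chart_def subtopology_subtopology Int_absorb1)
qed

text \<open>Over \<open>(1, 1)\<close> the equations say \<open>|X\<^sub>3| = 1\<close> and \<open>Re X\<^sub>3 = -1/2\<close>: the primitive cube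
  roots of unity, one on each sheet.\<close>

lemma sheet_nonempty:
  assumes "\<bar>s\<bar> = 1"
  shows "sheet s \<noteq> {}"
proof -
  have "(vector [1, 1] :: complex^2) \<in> projection_image"
    by (simp add: projection_image_def P_domain_def)
  with assms show ?thesis
    using section_of_in_sheet by blast
qed

lemma sheets_partition_Xstar:
  "Xstar_plus \<union> Xstar_minus = Xstar" "Xstar_plus \<inter> Xstar_minus = {}"
  by (auto simp: Xstar_plus_def Xstar_minus_def Xstar_def)

lemma not_connected_Xstar: "\<not> connected Xstar"
proof -
  have "openin (top_of_set Xstar) Xstar_plus" "openin (top_of_set Xstar) Xstar_minus"
    "Xstar_plus \<noteq> {}" "Xstar_minus \<noteq> {}"
    by (simp_all add: sheet_eq openin_sheet sheet_nonempty)
  with sheets_partition_Xstar show ?thesis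
    unfolding connected_openin by blast
qed

lemma complex_atlas_I: "complex_atlas (top_of_set Xstar) atlas_I"
proof (rule complex_atlas_disjoint)
  fix c :: "(complex^3, 2) chart" assume "c \<in> atlas_I"
  then show "complex_chart (top_of_set Xstar) c"
    using complex_chart_sheet[of 1] complex_chart_sheet[of "-1"]
      homeomorphic_maps_M_plus homeomorphic_maps_M_minus
    by (auto simp: atlas_I_def sheet_eq)
qed (use sheets_partition_Xstar in \<open>auto simp: atlas_I_def\<close>)

lemma complex_atlas_P: "complex_atlas (top_of_set P_domain) atlas_P"
  by (rule complex_atlas_disjoint)
     (auto simp: atlas_P_def complex_chart_def open_P_domain subtopology_subtopology)

lemma restrict_atlas_I:
  "restrict_atlas atlas_I Xstar_plus = {(Xstar_plus, M_plus), ({}, M_minus)}"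
  "restrict_atlas atlas_I Xstar_minus = {(Xstar_minus, M_minus), ({}, M_plus)}"
  using sheets_partition_Xstar(2) by (auto simp: restrict_atlas_def atlas_I_def)

theorem theorem4p2:
  shows "complex_manifold (top_of_set Xstar) atlas_I \<and>
    \<not> connected Xstar \<and>
    Xstar_plus \<noteq> {} \<and> Xstar_minus \<noteq> {} \<and> Xstar_plus \<inter> Xstar_minus = {} \<and>
    complex_manifold (top_of_set P_domain) atlas_P \<and>
    M_plus ` Xstar_plus \<subseteq> P_domain \<and> M_minus ` Xstar_minus \<subseteq> P_domain \<and>
    inherits_complex_structure_via
      (top_of_set Xstar_plus) (restrict_atlas atlas_I Xstar_plus)
      (top_of_set P_domain) atlas_P M_plus \<and>
    inherits_complex_structure_via
      (top_of_set Xstar_minus) (restrict_atlas atlas_I Xstar_minus)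
      (top_of_set P_domain) atlas_P M_minus"
proof (intro conjI)
  have sub: "projection_image \<subseteq> P_domain"
    by (auto simp: projection_image_def)
  show "complex_manifold (top_of_set Xstar) atlas_I"
    by (rule complex_manifold_top_of_set) (rule complex_atlas_I)
  show "\<not> connected Xstar"
    by (rule not_connected_Xstar)
  show "Xstar_plus \<noteq> {}" "Xstar_minus \<noteq> {}" "Xstar_plus \<inter> Xstar_minus = {}"
    by (simp_all add: sheets_partition_Xstar(2)) (simp_all add: sheet_eq sheet_nonempty)
  show "complex_manifold (top_of_set P_domain) atlas_P"
    by (rule complex_manifold_top_of_set) (rule complex_atlas_P)
  show "M_plus ` Xstar_plus \<subseteq> P_domain" "M_minus ` Xstar_minus \<subseteq> P_domain"
    using sub M_proj_sheet by (auto simp: M_plus_def M_minus_def sheet_eq)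
  show "inherits_complex_structure_via
      (top_of_set Xstar_plus) (restrict_atlas atlas_I Xstar_plus)
      (top_of_set P_domain) atlas_P M_plus"
    unfolding restrict_atlas_I atlas_P_def
    using homeomorphic_maps_M_plus open_projection_image sub
    by (rule inherits_complex_structure_single_chart)
  show "inherits_complex_structure_via
      (top_of_set Xstar_minus) (restrict_atlas atlas_I Xstar_minus)
      (top_of_set P_domain) atlas_P M_minus"
    unfolding restrict_atlas_I atlas_P_def
    using homeomorphic_maps_M_minus open_projection_image sub
    by (rule inherits_complex_structure_single_chart)
qed

end
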